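(* Let $F$ be a field and let $m,n_1,\dots,n_k$ be positive integers such that the characteristic of $F$ is zero or coprime to every $n_i$. For $i=1,\dots,k$ let $g_i(X)=\sum_{j=0}^{n_i-1}g_{ij}X^j\in F[X]$, and let $M(g_1,\dots,g_k)_{m\times(n_1+\cdots+n_k)}$ be the multiple circulant matrix associated with $g_1(X),\dots,g_k(X)$. Let $$s=\deg\operatorname{lcm}\left(\frac{X^{n_1}-1}{\gcd\big(g_1(X),X^{n_1}-1\big)},\;\dots,\;\frac{X^{n_k}-1}{\gcd\big(g_k(X),X^{n_k}-1\big)}\right)$$ and let $r=\min\{m,s\}$. Then any consecutive $r$ rows of $M(g_1,\dots,g_k)_{m\times(n_1+\cdots+n_k)}$ are linearly independent.
   Context: For a polynomial $g(X)=\sum_{j=0}^{n-1}g_jX^j$ over $F$ of degree less than $n$, the generalized circulant matrix $M(g)_{m\times n}$ is the $m\times n$ matrix over $F$ whose $i$-th row ($i=0,1,\dots,m-1$, rows counted from $0$) is $\mathcal S^i(g_0,g_1,\dots,g_{n-1})$, where $\mathcal S(a_0,a_1,\dots,a_{n-1})=(a_{n-1},a_0,\dots,a_{n-2})$ is the circular shift on $F^n$. Equivalently, its $(i,j)$ entry ($0\le i<m$, $0\le j<n$) is $g_{(j-i)\bmod n}$. The multiple circulant matrix associated with $g_1(X),\dots,g_k(X)$ (with $\deg g_i<n_i$) is the side-by-side concatenation $M(g_1,\dots,g_k)_{m\times(n_1+\cdots+n_k)}=\big(M(g_1)_{m\times n_1}\,\big|\,\cdots\,\big|\,M(g_k)_{m\times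 n_k}\big)$. Here $\gcd$ and $\operatorname{lcm}$ of polynomials are taken in $F[X]$ (with $\gcd(0,f)=f$). "Consecutive $r$ rows" means rows $i,i+1,\dots,i+r-1$ for some $i$ with $0\le i\le m-r$. *)

theory Defs
  imports
    "HOL-Computational_Algebra.Polynomial_Factorial"
    "Jordan_Normal_Form.VS_Connect"
begin

(* The library provides gcd and Lcm on 'a poly only for coefficients of class field_gcd, and not
   every field type carries that structure (e.g. fraction fields of polynomial rings). To cover an
   arbitrary 'a :: field we define the usual monic gcd and lcm here. Below it is shown that they
   are well defined and that they agree with gcd and Lcm whenever the latter are available. *)

definition is_monic_gcd :: "'a::field poly \<Rightarrow> 'a poly \<Rightarrow> 'a poly \<Rightarrow> bool" where
  "is_monic_gcd p q d \<longleftrightarrow>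
     d dvd p \<and> d dvd q \<and> (\<forall>c. c dvd p \<longrightarrow> c dvd q \<longrightarrow> c dvd d) \<and> (d = 0 \<or> lead_coeff d = 1)"

definition poly_gcd :: "'a::field poly \<Rightarrow> 'a poly \<Rightarrow> 'a poly" where
  "poly_gcd p q = (THE d. is_monic_gcd p q d)"

definition is_monic_Lcm :: "'a::field poly set \<Rightarrow> 'a poly \<Rightarrow> bool" where
  "is_monic_Lcm A l \<longleftrightarrow>
     (\<forall>p\<in>A. p dvd l) \<and> (\<forall>c. (\<forall>p\<in>A. p dvd c) \<longrightarrow> l dvd c) \<and> (l = 0 \<or> lead_coeff l = 1)"

definition poly_Lcm :: "'a::field poly set \<Rightarrow> 'a poly" where
  "poly_Lcm A = (THE l. is_monic_Lcm A l)"

lemma monic_dvd_antisym: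
  fixes p q :: "'a::field poly"
  assumes "p dvd q" "q dvd p" "p = 0 \<or> lead_coeff p = 1" "q = 0 \<or> lead_coeff q = 1"
  shows "p = q"
proof (cases "p = 0 \<or> q = 0")
  case True
  then show ?thesis using assms by auto
next
  case False
  obtain u where u: "q = p * u" using assms(1) by (elim dvdE)
  have "degree q \<le> degree p" using assms(2) False by (intro dvd_imp_degree_le) auto
  then have "degree u = 0" using u False by (auto simp: degree_mult_eq)
  then obtain c where c: "u = [:c:]" by (elim degree_eq_zeroE)
  have "lead_coeff q = lead_coeff p * lead_coeff u" using u by (simp add: lead_coeff_mult)
  then have "c = 1" using assms(3,4) False c by simp
  then show ?thesis using u c by simp
qed

lemma is_monic_gcd_unique: "is_monic_gcd p q d \<Longrightarrow> is_monic_gcd p q e \<Longrightarrow> d = e"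
  unfolding is_monic_gcd_def by (intro monic_dvd_antisym) auto

lemma is_monic_Lcm_unique: "is_monic_Lcm A l \<Longrightarrow> is_monic_Lcm A l' \<Longrightarrow> l = l'"
  unfolding is_monic_Lcm_def by (intro monic_dvd_antisym) auto

lemma is_monic_Lcm_ex: "\<exists>l. is_monic_Lcm A l"
proof (cases "\<exists>c. c \<noteq> 0 \<and> (\<forall>p\<in>A. p dvd c)")
  case False
  then have "is_monic_Lcm A 0" by (auto simp: is_monic_Lcm_def)
  then show ?thesis ..
next
  case True
  let ?P = "\<lambda>c. c \<noteq> 0 \<and> (\<forall>p\<in>A. p dvd c)"
  obtain l where l: "?P l" and min: "\<And>c. ?P c \<Longrightarrow> degree l \<le> degree c"
    using True exists_least_iff[of "\<lambda>d. \<exists>c. ?P c \<and> degree c = d"] by (metis linorder_not_le)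
  have dvd: "l dvd c" if c: "\<forall>p\<in>A. p dvd c" for c
  proof (rule ccontr)
    assume "\<not> l dvd c"
    then have nz: "c mod l \<noteq> 0" by (simp add: dvd_eq_mod_eq_0)
    have "\<forall>p\<in>A. p dvd c mod l" using c l by (simp add: dvd_mod)
    then have "degree l \<le> degree (c mod l)" using nz min by blast
    moreover have "degree (c mod l) < degree l" using l nz degree_mod_less[of l c] by auto
    ultimately show False by simp
  qed
  let ?u = "inverse (lead_coeff l)"
  have u: "?u \<noteq> 0" using l by simp
  have "is_monic_Lcm A (Polynomial.smult ?u l)"
    unfolding is_monic_Lcm_def using l dvd u by (auto simp: dvd_smult smult_dvd)
  then show ?thesis ..
qed

lemma is_monic_gcd_ex: "\<exists>d. is_monic_gcd p q d"
proof -
  obtain d where "is_monic_Lcm {c. c dvd p \<and> c dvd q} d" using is_monic_Lcm_ex by blast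
  then have "is_monic_gcd p q d" unfolding is_monic_Lcm_def is_monic_gcd_def by auto
  then show ?thesis ..
qed

lemma poly_gcd_eqI: "is_monic_gcd p q d \<Longrightarrow> poly_gcd p q = d"
  unfolding poly_gcd_def by (blast intro: the_equality is_monic_gcd_unique)

lemma poly_Lcm_eqI: "is_monic_Lcm A l \<Longrightarrow> poly_Lcm A = l"
  unfolding poly_Lcm_def by (blast intro: the_equality is_monic_Lcm_unique)

lemma is_monic_gcd_poly_gcd: "is_monic_gcd p q (poly_gcd p q)"
  using is_monic_gcd_ex poly_gcd_eqI by metis

lemma is_monic_Lcm_poly_Lcm: "is_monic_Lcm A (poly_Lcm A)"
  using is_monic_Lcm_ex poly_Lcm_eqI by metis

lemma normalized_poly_monic:
  fixes p :: "'a::field_gcd poly"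
  assumes "normalize p = p"
  shows "p = 0 \<or> lead_coeff p = 1"
proof (cases "p = 0")
  case False
  have "lead_coeff p = normalize (lead_coeff p)"
    using arg_cong[OF assms, of "\<lambda>q. coeff q (degree p)"] by simp
  also have "\<dots> = 1" using False by (simp add: is_unit_normalize dvd_field_iff)
  finally show ?thesis ..
qed simp

lemma poly_gcd_eq_gcd: "poly_gcd p q = gcd p q" for p q :: "'a::field_gcd poly"
  by (rule poly_gcd_eqI) (use normalized_poly_monic[of "gcd p q"] in \<open>auto simp: is_monic_gcd_def\<close>)

lemma poly_Lcm_eq_Lcm: "poly_Lcm A = Lcm A" for A :: "'a::field_gcd poly set"
  by (rule poly_Lcm_eqI)
     (use normalized_poly_monic[of "Lcm A"] in \<open>auto simp: is_monic_Lcm_def intro: dvd_Lcm Lcm_least\<close>)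

(* The predecessor of index j is written j + dim_vec a - 1, not j - 1, because nat subtraction
   truncates at j = 0. *)
definition circular_shift :: "'a vec \<Rightarrow> 'a vec" where
  "circular_shift a = vec (dim_vec a) (\<lambda>j. a $ ((j + dim_vec a - 1) mod dim_vec a))"

definition gen_circulant :: "nat \<Rightarrow> nat \<Rightarrow> 'a::zero poly \<Rightarrow> 'a mat" where
  "gen_circulant m n g =
     mat_of_rows n (map (\<lambda>i. (circular_shift ^^ i) (vec n (coeff g))) [0..<m])"

lemma circular_shift_pow_index:
  assumes "j < dim_vec a"
  shows "(circular_shift ^^ i) a $ j = a $ nat ((int j - int i) mod int (dim_vec a))"
    and "dim_vec ((circular_shift ^^ i) a) = dim_vec a"
proof -
  show dim: "dim_vec ((circular_shift ^^ i) a) = dim_vec a" for i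
    by (induction i) (auto simp: circular_shift_def)
  show "(circular_shift ^^ i) a $ j = a $ nat ((int j - int i) mod int (dim_vec a))"
    using assms
  proof (induction i arbitrary: j)
    case (Suc i)
    let ?n = "dim_vec a"
    let ?j = "(j + ?n - 1) mod ?n"
    have n: "0 < ?n" using Suc.prems by auto
    have "int (j + ?n - 1) = int j - 1 + int ?n" using n by auto
    then have j: "int ?j = (int j - 1) mod int ?n" by (simp add: zmod_int)
    have "(circular_shift ^^ Suc i) a $ j = (circular_shift ^^ i) a $ ?j"
      using Suc.prems by (simp add: circular_shift_def dim)
    also have "\<dots> = a $ nat ((int ?j - int i) mod int ?n)" using Suc.IH n by simp
    also have "(int ?j - int i) mod int ?n = (int j - int (Suc i)) mod int ?n"
      unfolding j by (simp add: mod_diff_left_eq algebra_simps)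
    finally show ?case .
  qed simp
qed

lemma gen_circulant_index:
  assumes "i < m" "j < n"
  shows "gen_circulant m n g $$ (i, j) = coeff g (nat ((int j - int i) mod int n))"
proof -
  have "nat ((int j - int i) mod int n) < n" using assms by (simp add: nat_less_iff)
  then show ?thesis
    using assms circular_shift_pow_index(1)[of j "vec n (coeff g)" i]
    by (simp add: gen_circulant_def mat_of_rows_index)
qed

definition multiple_circulant ::
    "nat \<Rightarrow> nat \<Rightarrow> (nat \<Rightarrow> nat) \<Rightarrow> (nat \<Rightarrow> 'a::zero poly) \<Rightarrow> 'a mat" where
  "multiple_circulant m k n g =
     mat_of_cols m (concat (map (\<lambda>i. cols (gen_circulant m (n i) (g i))) [1..<Suc k]))"

lemma multiple_circulant_carrier:
  "multiple_circulant m k n g \<in> carrier_mat m (\<Sum>l=1..k. n l)"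
proof -
  have "(\<Sum>l\<leftarrow>[1..<Suc k]. n l) = (\<Sum>l=1..k. n l)"
    by (simp only: atLeastLessThan_upt[symmetric] sum_set_upt_conv_sum_list_nat[symmetric]
        atLeastLessThanSuc_atLeastAtMost)
  then show ?thesis
    unfolding multiple_circulant_def carrier_mat_def
    by (simp add: length_concat o_def gen_circulant_def del: upt_Suc)
qed

(* Independence of a family of vectors: distinctness is needed because module.lin_dep is a
   predicate on sets and therefore ignores repetitions. *)
definition lin_indpt_list :: "nat \<Rightarrow> 'a::field vec list \<Rightarrow> bool" where
  "lin_indpt_list N vs \<longleftrightarrow> set vs \<subseteq> carrier_vec N \<and> distinct vs \<and>
     \<not> module.lin_dep class_ring (module_vec TYPE('a) N) (set vs)"

end

theory Submission
  imports Defs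
begin

text \<open>
  Identify a vector of length \<open>n\<close> with the polynomial having its entries as coefficients.
  The circular shift then becomes multiplication by \<open>X\<close> modulo \<open>X ^ n - 1\<close>, so the combination
  of the rows \<open>i, \<dots>, i + r - 1\<close> with coefficients \<open>c\<^sub>0, \<dots>, c\<^sub>r\<^sub>-\<^sub>1\<close> represents, in the \<open>l\<close>-th block,
  the product \<open>X ^ i * c * g l\<close> modulo \<open>X ^ n l - 1\<close>, where \<open>c\<close> is the polynomial with these
  coefficients.

  Suppose the combination vanishes. As \<open>X\<close> is invertible modulo \<open>X ^ n l - 1\<close>, this modulus
  divides \<open>c * g l\<close>, and hence its quotient by the gcd with \<open>g l\<close> divides \<open>c\<close>. This holds for every
  block, so the lcm of the quotients, which has degree \<open>s\<close>, divides \<open>c\<close>. But \<open>c\<close> has degree less than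
  \<open>r \<le> s\<close>, and therefore \<open>c = 0\<close>.

  The two bridges between matrices and polynomials are \<open>vec_poly_circular_shift_pow\<close> and
  \<open>multiple_circulant_block_relation\<close>; the divisibility argument rests on
  \<open>cofactor_of_gcd_dvd\<close>.
\<close>

section \<open>Divisibility of polynomials over a field\<close>

text \<open>
  A common divisor \<open>D\<close> of \<open>c * g\<close> and \<open>c * p\<close> that is a multiple of \<open>c\<close> has the form \<open>c * t\<close> with \<open>t\<close> a
  common divisor of \<open>g\<close> and \<open>p\<close>. Hence the gcd of the two products divides \<open>c\<close> times the gcd of \<open>g\<close> and
  \<open>p\<close>; as \<open>p\<close> divides both products, it divides this polynomial too, and the gcd can be cancelled.
\<close>
lemma cofactor_of_gcd_dvd:
  fixes p g c :: "'a::field poly"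
  assumes "p \<noteq> 0" and "p dvd c * g"
  shows "p div poly_gcd g p dvd c"
proof (cases "c = 0")
  case False
  define d where "d = poly_gcd g p"
  have d: "d dvd p" "\<And>t. t dvd g \<Longrightarrow> t dvd p \<Longrightarrow> t dvd d"
    using is_monic_gcd_poly_gcd[of g p] by (auto simp: is_monic_gcd_def d_def)
  obtain D where "is_monic_gcd (c * g) (c * p) D"
    using is_monic_gcd_ex by blast
  then have D: "D dvd c * g" "D dvd c * p" "\<And>t. t dvd c * g \<Longrightarrow> t dvd c * p \<Longrightarrow> t dvd D"
    by (auto simp: is_monic_gcd_def)
  have "c dvd D" by (rule D(3)) simp_all
  then obtain t where t: "D = c * t" by (elim dvdE)
  have "t dvd d" using D(1,2) False by (intro d(2)) (auto simp: t)
  have "p dvd c * t" using assms(2) unfolding t[symmetric] by (intro D(3)) simp_all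
  from this \<open>t dvd d\<close> have "p dvd c * d"
    by (rule dvd_trans[OF _ mult_dvd_mono[OF dvd_refl]])
  then have "(p div d) * d dvd c * d" using d(1) by simp
  moreover have "d \<noteq> 0" using d(1) assms(1) by auto
  ultimately show ?thesis by (simp only: dvd_mult_cancel_right d_def[symmetric] simp_thms)
qed simp

text \<open>
  Multiplying by a further power of \<open>X\<close> turns \<open>X ^ i\<close> into \<open>X ^ (n * i)\<close>, which is congruent to \<open>1\<close>
  modulo \<open>X ^ n - 1\<close>.
\<close>
lemma cyclic_modulus_dvd_cancel_monom:
  fixes q :: "'a::comm_ring_1 poly"
  assumes "0 < n" and "monom 1 n - 1 dvd monom 1 i * q"
  shows "monom 1 n - 1 dvd q"
proof -
  have "monom 1 n - 1 dvd monom (1 :: 'a) (n * i) - 1"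
    using power_diff_1_eq[of "monom (1 :: 'a) n" i] by (auto simp: monom_power)
  then have a: "monom 1 n - 1 dvd (monom 1 (n * i) - 1) * q" by simp
  have "n * i = (n - 1) * i + i" using assms(1) by (cases n) auto
  then have "monom (1 :: 'a) (n * i) * q = monom 1 ((n - 1) * i) * (monom 1 i * q)"
    by (simp add: mult_monom flip: mult.assoc)
  then have "monom 1 n - 1 dvd monom 1 (n * i) * q" using assms(2) by simp
  from dvd_diff[OF this a] show ?thesis by (simp add: algebra_simps)
qed

section \<open>Circular shifts as multiplication by the indeterminate\<close>

definition vec_poly :: "'a::comm_ring_1 vec \<Rightarrow> 'a poly" where
  "vec_poly v = (\<Sum>j<dim_vec v. monom (v $ j) j)"

lemma vec_poly_coeffs:
  assumes "degree p < n"
  shows "vec_poly (vec n (coeff p)) = p"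
proof -
  have "vec_poly (vec n (coeff p)) = (\<Sum>j\<le>n - 1. monom (coeff p j) j)"
    using assms by (cases n) (simp_all add: vec_poly_def lessThan_Suc_atMost)
  also have "\<dots> = p" using assms by (intro poly_as_sum_of_monoms') auto
  finally show ?thesis .
qed

text \<open>
  The two polynomials differ only in the last entry of \<open>a\<close>, which multiplication by \<open>X\<close> moves to
  \<open>X ^ n\<close> and the shift moves to the constant term.
\<close>
lemma vec_poly_circular_shift:
  assumes "0 < dim_vec a"
  shows "monom 1 (dim_vec a) - 1 dvd monom 1 1 * vec_poly a - vec_poly (circular_shift a)"
proof -
  obtain p where p: "dim_vec a = Suc p" using assms by (cases "dim_vec a") auto
  have idx: "Suc (j + p) mod Suc p = j" if "j < p" for j
    using that mod_add_self2[of j "Suc p"] by simp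
  have "vec_poly (circular_shift a) = monom (a $ p) 0 + (\<Sum>j<p. monom (a $ j) (Suc j))"
    unfolding vec_poly_def circular_shift_def
    by (simp add: p idx sum.lessThan_Suc_shift del: sum.lessThan_Suc)
  moreover have "monom 1 1 * vec_poly a = (\<Sum>j<p. monom (a $ j) (Suc j)) + monom (a $ p) (Suc p)"
    unfolding vec_poly_def by (simp add: p sum_distrib_left distrib_left mult_monom)
  ultimately have "monom 1 1 * vec_poly a - vec_poly (circular_shift a)
      = [:a $ p:] * (monom 1 (dim_vec a) - 1)"
    by (simp add: p algebra_simps smult_monom monom_0 smult_diff_right)
  then show ?thesis by (simp only: dvd_triv_right)
qed

lemma vec_poly_circular_shift_pow:
  assumes "0 < dim_vec a"
  shows "monom 1 (dim_vec a) - 1 dvd monom 1 i * vec_poly a - vec_poly ((circular_shift ^^ i) a)"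
proof (induction i)
  case (Suc i)
  let ?b = "(circular_shift ^^ i) a"
  have dim: "dim_vec ?b = dim_vec a" using circular_shift_pow_index(2) assms by blast
  have "monom 1 (dim_vec a) - 1 dvd monom 1 1 * vec_poly ?b - vec_poly (circular_shift ?b)"
    using vec_poly_circular_shift[of ?b] assms by (simp add: dim)
  moreover have "monom 1 (dim_vec a) - 1 dvd monom 1 1 * (monom 1 i * vec_poly a - vec_poly ?b)"
    using Suc.IH by simp
  ultimately have "monom 1 (dim_vec a) - 1 dvd
      monom 1 1 * (monom 1 i * vec_poly a - vec_poly ?b)
      + (monom 1 1 * vec_poly ?b - vec_poly (circular_shift ?b))"
    by (rule dvd_add[rotated])
  also have "\<dots> = monom 1 (Suc i) * vec_poly a - vec_poly ((circular_shift ^^ Suc i) a)"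
    by (simp add: right_diff_distrib mult_monom flip: mult.assoc)
  finally show ?case .
qed simp

text \<open>
  A linear relation between rows \<open>i, \<dots>, i + r - 1\<close> of a circulant matrix is a relation
  \<open>X ^ i * c * g = 0\<close> in the quotient ring by \<open>X ^ n - 1\<close>. As \<open>X\<close> is a unit there, the factor \<open>X ^ i\<close>
  disappears, so the conclusion does not depend on where the consecutive rows start.
\<close>
lemma circulant_relation_dvd:
  fixes g :: "'a::comm_ring_1 poly"
  assumes "degree g < n" and "i + r \<le> m"
    and rel: "\<And>t. t < n \<Longrightarrow> (\<Sum>j<r. c j * gen_circulant m n g $$ (i + j, t)) = 0"
  shows "monom 1 n - 1 dvd (\<Sum>j<r. monom (c j) j) * g"
proof -
  let ?a = "vec n (coeff g)"
  let ?P = "monom (1 :: 'a) n - 1"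
  let ?w = "\<lambda>j. vec_poly ((circular_shift ^^ (i + j)) ?a)"
  have n: "0 < n" using assms(1) by simp
  have dim: "dim_vec ((circular_shift ^^ j) ?a) = n" for j
    using circular_shift_pow_index(2)[of 0 ?a j] n by simp
  have entry: "(circular_shift ^^ (i + j)) ?a $ t = gen_circulant m n g $$ (i + j, t)"
    if "j < r" "t < n" for j t
    using that assms(2) by (simp add: gen_circulant_def mat_of_rows_index)
  have "(\<Sum>j<r. monom (c j) 0 * ?w j)
      = (\<Sum>j<r. \<Sum>t<n. monom (c j * gen_circulant m n g $$ (i + j, t)) t)"
    by (simp add: vec_poly_def dim entry sum_distrib_left mult_monom)
  also have "\<dots> = (\<Sum>t<n. monom (\<Sum>j<r. c j * gen_circulant m n g $$ (i + j, t)) t)"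
    by (subst sum.swap) (simp add: monom_sum)
  also have "\<dots> = 0" by (simp add: rel)
  finally have zero: "(\<Sum>j<r. monom (c j) 0 * ?w j) = 0" .
  have "?P dvd (\<Sum>j<r. monom (c j) 0 * (monom 1 (i + j) * g - ?w j))"
    using vec_poly_circular_shift_pow[of ?a] n
    by (intro dvd_sum dvd_mult) (simp add: vec_poly_coeffs[OF assms(1)])
  also have "\<dots> = (\<Sum>j<r. monom (c j) 0 * (monom 1 (i + j) * g))"
    using zero by (simp only: right_diff_distrib sum_subtractf diff_zero)
  also have "\<dots> = monom 1 i * ((\<Sum>j<r. monom (c j) j) * g)"
    by (simp add: sum_distrib_left sum_distrib_right mult_monom flip: mult.assoc)
  finally show ?thesis by (rule cyclic_modulus_dvd_cancel_monom[OF n])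
qed

section \<open>Linear independence of rows\<close>

text \<open>
  The library notion of dependence speaks about sets of vectors. Indexed coefficients also exclude
  repeated vectors, since two equal members of the list would be cancelled by the coefficients
  \<open>1\<close> and \<open>- 1\<close>.
\<close>
lemma lin_indpt_list_mapI:
  fixes f :: "nat \<Rightarrow> 'a::field vec"
  assumes carrier: "\<And>j. j < r \<Longrightarrow> f j \<in> carrier_vec N"
    and indep: "\<And>c j. (\<And>t. t < N \<Longrightarrow> (\<Sum>j<r. c j * f j $ t) = 0) \<Longrightarrow> j < r \<Longrightarrow> c j = 0"
  shows "lin_indpt_list N (map f [0..<r])"
proof -
  interpret vec_space "TYPE('a)" N .
  have inj: "inj_on f {..<r}"
  proof (rule inj_onI, rule ccontr)
    fix a b assume ab: "a \<in> {..<r}" "b \<in> {..<r}" "f a = f b" "a \<noteq> b"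
    define c :: "nat \<Rightarrow> 'a" where "c j = (if j = a then 1 else 0) - (if j = b then 1 else 0)" for j
    have "(\<Sum>j<r. c j * f j $ t) = 0" for t
    proof -
      have "(\<Sum>j<r. c j * f j $ t)
          = (\<Sum>j<r. if j = a then f j $ t else 0) - (\<Sum>j<r. if j = b then f j $ t else 0)"
        unfolding sum_subtractf[symmetric] by (intro sum.cong) (auto simp: c_def)
      then show ?thesis using ab by simp
    qed
    then have "c a = 0" using indep[of c a] ab(1) by blast
    then show False using ab(4) by (simp add: c_def)
  qed
  have sub: "f ` {..<r} \<subseteq> carrier_vec N" using carrier by auto
  have "\<not> lin_dep (f ` {..<r})"
  proof
    assume ld: "lin_dep (f ` {..<r})"
    obtain a v where zero: "lincomb a (f ` {..<r}) = 0\<^sub>v N"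
      and v: "v \<in> f ` {..<r}" "a v \<noteq> 0"
      using finite_lin_dep[OF _ ld] sub by (auto simp: module_vec_simps class_ring_simps)
    have "(\<Sum>j<r. a (f j) * f j $ t) = 0" if "t < N" for t
    proof -
      have "(\<Sum>j<r. a (f j) * f j $ t) = lincomb a (f ` {..<r}) $ t"
        using that by (simp add: lincomb_index[OF that sub] sum.reindex[OF inj])
      also have "\<dots> = 0" using that by (simp add: zero)
      finally show ?thesis .
    qed
    then have "a (f j) = 0" if "j < r" for j using indep[of "\<lambda>j. a (f j)" j] that by blast
    then show False using v by blast
  qed
  then show ?thesis
    using inj sub by (simp add: lin_indpt_list_def distinct_map atLeast0LessThan)
qed

text \<open>Every column of a block occurs among the columns of the concatenation.\<close>
lemma multiple_circulant_block_relation: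
  fixes c :: "nat \<Rightarrow> 'a::comm_ring_1"
  assumes "l \<in> {1..k}" and "t < n l" and "i + r \<le> m"
    and rel: "\<And>t. t < (\<Sum>l=1..k. n l) \<Longrightarrow>
      (\<Sum>j<r. c j * row (multiple_circulant m k n g) (i + j) $ t) = 0"
  shows "(\<Sum>j<r. c j * gen_circulant m (n l) (g l) $$ (i + j, t)) = 0"
proof -
  let ?M = "multiple_circulant m k n g"
  let ?G = "gen_circulant m (n l) (g l)"
  let ?cs = "concat (map (\<lambda>i. cols (gen_circulant m (n i) (g i))) [1..<Suc k])"
  have M: "?M = mat_of_cols m ?cs" by (simp add: multiple_circulant_def)
  have G: "?G \<in> carrier_mat m (n l)" by (simp add: gen_circulant_def mat_of_rows_def)
  have "col ?G t \<in> set (cols ?G)" using G assms(2) by (auto simp: cols_def)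
  then have "col ?G t \<in> set ?cs" using assms(1) by (auto simp del: upt_Suc)
  then obtain u where u: "u < length ?cs" "?cs ! u = col ?G t"
    by (blast dest: in_set_conv_nth[THEN iffD1])
  have dim: "?M \<in> carrier_mat m (\<Sum>l=1..k. n l)" by (rule multiple_circulant_carrier)
  have uN: "u < (\<Sum>l=1..k. n l)"
    using u(1) dim unfolding M carrier_mat_def by (simp del: upt_Suc)
  have "row ?M (i + j) $ u = ?G $$ (i + j, t)" if "j < r" for j
  proof -
    have ij: "i + j < m" using that assms(3) by simp
    have "row ?M (i + j) $ u = ?M $$ (i + j, u)" using dim ij uN by simp
    also have "\<dots> = col ?G t $ (i + j)"
      unfolding M using ij u by (simp add: mat_of_cols_index del: upt_Suc)
    also have "\<dots> = ?G $$ (i + j, t)" using G ij assms(2) by simp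
    finally show ?thesis .
  qed
  then show ?thesis using rel[OF uN] by simp
qed

theorem corollary5p4:
  fixes g :: "nat \<Rightarrow> 'a::field poly"
    and n :: "nat \<Rightarrow> nat"
    and m k s r :: nat
  assumes "0 < m" and "0 < k"
    and "\<forall>i\<in>{1..k}. 0 < n i"
    and "CHAR('a) = 0 \<or> (\<forall>i\<in>{1..k}. coprime CHAR('a) (n i))"
    and "\<forall>i\<in>{1..k}. degree (g i) < n i"
    and "s = degree (poly_Lcm ((\<lambda>i. (monom 1 (n i) - 1) div
               poly_gcd (g i) (monom 1 (n i) - 1)) ` {1..k}))"
    and "r = min m s"
  shows "\<forall>i. i \<le> m - r \<longrightarrow>
           lin_indpt_list (\<Sum>l=1..k. n l)
             (map (row (multiple_circulant m k n g)) [i..<i + r])"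
proof (intro allI impI)
  fix i assume "i \<le> m - r"
  then have ir: "i + r \<le> m" using assms(7) by simp
  let ?N = "\<Sum>l=1..k. n l"
  let ?M = "multiple_circulant m k n g"
  let ?P = "\<lambda>l. monom (1 :: 'a) (n l) - 1"
  let ?q = "\<lambda>l. ?P l div poly_gcd (g l) (?P l)"
  let ?L = "poly_Lcm (?q ` {1..k})"
  have P0: "?P l \<noteq> 0" if "l \<in> {1..k}" for l
  proof
    assume "?P l = 0"
    then have "coeff (?P l) (n l) = 0" by simp
    moreover have "0 < n l" using that assms(3) by blast
    ultimately show False by simp
  qed
  have "lin_indpt_list ?N (map (\<lambda>j. row ?M (i + j)) [0..<r])"
  proof (rule lin_indpt_list_mapI)
    show "row ?M (i + j) \<in> carrier_vec ?N" for j
      using row_carrier[of ?M] multiple_circulant_carrier[of m k n g] by (metis carrier_matD(2))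
  next
    fix c j assume rel: "\<And>t. t < ?N \<Longrightarrow> (\<Sum>j<r. c j * row ?M (i + j) $ t) = 0" and j: "j < r"
    define C where "C = (\<Sum>j<r. monom (c j) j)"
    have "?q l dvd C" if l: "l \<in> {1..k}" for l
    proof (rule cofactor_of_gcd_dvd[OF P0[OF l]])
      have "degree (g l) < n l" using assms(5) l by blast
      then show "?P l dvd C * g l"
        unfolding C_def using multiple_circulant_block_relation[OF l _ ir rel]
        by (intro circulant_relation_dvd[OF _ ir]) auto
    qed
    then have LC: "?L dvd C"
      using is_monic_Lcm_poly_Lcm[of "?q ` {1..k}"] by (auto simp: is_monic_Lcm_def)
    have coeff_C: "coeff C t = (if t < r then c t else 0)" for t
      by (simp add: C_def coeff_sum)
    have "C = 0"
    proof (rule ccontr)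
      assume "C \<noteq> 0"
      then have "s \<le> degree C" using dvd_imp_degree_le[OF LC] assms(6) by simp
      moreover have "degree C < r"
        using \<open>C \<noteq> 0\<close> coeff_C[of "degree C"] by (auto split: if_splits)
      ultimately show False using assms(7) by simp
    qed
    then show "c j = 0" using coeff_C[of j] j by simp
  qed
  moreover have "map (\<lambda>j. row ?M (i + j)) [0..<r] = map (row ?M) [i..<i + r]"
    by (rule nth_equalityI) auto
  ultimately show "lin_indpt_list ?N (map (row ?M) [i..<i + r])" by simp
qed

end
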